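(* Let $q\in(0,1)$. For any $f \in C[0,1]$, $$M(r;D_{\infty,q}f)=o\big((-r;q)_{\infty}\big), \quad r \to \infty.$$
   Context: For $a\in\mathbb{C}$ and $0<q<1$, the $q$-Pochhammer symbols are $(a;q)_0=1$, $(a;q)_n=\prod_{j=0}^{n-1}(1-aq^j)$, $(a;q)_\infty=\prod_{j=0}^{\infty}(1-aq^j)$. The limit $q$-Durrmeyer operator is defined for $f\in C[0,1]$ by $(D_{\infty,q}f)(x)=\sum_{k=0}^{\infty} A_{\infty k}(f)\, p_{\infty k}(q;x)$ for $x\in[0,1)$ and $(D_{\infty,q}f)(1)=f(1)$, where $p_{\infty k}(q;x)=\frac{(x;q)_\infty\, x^k}{(q;q)_k}$ and $A_{\infty k}(f)=\frac{q^{-k}}{1-q}\int_0^1 f(t)\,p_{\infty k}(q;qt)\,d_qt$. Here the $q$-integral is $\int_0^a h(t)\,d_qt=(1-q)a\sum_{j=0}^\infty q^j h(aq^j)$. Equivalently, $A_{\infty k}(f)=\frac{(q;q)_\infty}{(q;q)_k}\sum_{j=0}^\infty \frac{f(q^j)q^{(k+1)j}}{(q;q)_j}$. The function $D_{\infty,q}f$ extends (uniquely) from $[0,1]$ to an entire function, still denoted $D_{\infty,q}f$. For a function $h$ analytic in the closed disc $\Delta_r=\{z\in\mathbb{C}:|z|\leqslant r\}$, $M(r;h)=\max_{z\in\Delta_r}|h(z)|$. *)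

theory Defs
  imports "HOL-Complex_Analysis.Complex_Analysis" "HOL-Library.Landau_Symbols"
begin

definition qpoch :: "'a::real_normed_field \<Rightarrow> 'a \<Rightarrow> nat \<Rightarrow> 'a" where
  "qpoch a q n = (\<Prod>j<n. 1 - a * q ^ j)"

definition qpoch_inf :: "'a::real_normed_field \<Rightarrow> 'a \<Rightarrow> 'a" where
  "qpoch_inf a q = (\<Prod>j. 1 - a * q ^ j)"

definition q_integral :: "real \<Rightarrow> real \<Rightarrow> (real \<Rightarrow> 'a::real_normed_vector) \<Rightarrow> 'a" where
  "q_integral q a h = ((1 - q) * a) *\<^sub>R (\<Sum>j. q ^ j *\<^sub>R h (a * q ^ j))"

definition p_inf :: "real \<Rightarrow> nat \<Rightarrow> real \<Rightarrow> real" where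
  "p_inf q k x = qpoch_inf x q * x ^ k / qpoch q q k"

definition A_inf :: "real \<Rightarrow> nat \<Rightarrow> (real \<Rightarrow> complex) \<Rightarrow> complex" where
  "A_inf q k f =
     (q powi (- int k) / (1 - q)) *\<^sub>R q_integral q 1 (\<lambda>t. p_inf q k (q * t) *\<^sub>R f t)"

text \<open>The operator on functions on \<open>[0,1]\<close>; its values outside \<open>[0,1]\<close> carry no meaning.\<close>

definition q_durrmeyer :: "real \<Rightarrow> (real \<Rightarrow> complex) \<Rightarrow> real \<Rightarrow> complex" where
  "q_durrmeyer q f x =
     (if x = 1 then f 1 else (\<Sum>k. p_inf q k x *\<^sub>R A_inf q k f))"

text \<open>The unique entire function that agrees with \<^term>\<open>q_durrmeyer q f\<close> on \<open>[0,1]\<close>.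
  If no such function existed, \<^term>\<open>q_durrmeyer_entire q f\<close> would be unspecified, so any
  use of its values requires a proof of existence.\<close>

definition q_durrmeyer_entire :: "real \<Rightarrow> (real \<Rightarrow> complex) \<Rightarrow> complex \<Rightarrow> complex" where
  "q_durrmeyer_entire q f =
     (THE F. F holomorphic_on UNIV \<and> (\<forall>x\<in>{0..1}. F (of_real x) = q_durrmeyer q f x))"

text \<open>A supremum, because \<^const>\<open>Max\<close> is only meaningful for finite sets; by the lemma below
  it is attained.\<close>

definition max_modulus :: "real \<Rightarrow> (complex \<Rightarrow> complex) \<Rightarrow> real" where
  "max_modulus r h = (SUP z\<in>cball 0 r. norm (h z))"

lemma max_modulus_attained:
  assumes "continuous_on (cball 0 r) h" and "0 \<le> r"
  shows "\<exists>z\<in>cball 0 r. max_modulus r h = norm (h z) \<and> (\<forall>w\<in>cball 0 r. norm (h w) \<le> norm (h z))"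
proof -
  have "continuous_on (cball 0 r) (\<lambda>z. norm (h z))"
    using assms(1) by (intro continuous_intros)
  moreover have "cball (0::complex) r \<noteq> {}"
    using assms(2) by simp
  ultimately obtain z where z: "z \<in> cball 0 r" "\<forall>w\<in>cball 0 r. norm (h w) \<le> norm (h z)"
    using continuous_attains_sup[OF compact_cball] by blast
  have "max_modulus r h = norm (h z)"
    unfolding max_modulus_def by (rule cSup_eq_maximum) (use z in auto)
  with z show ?thesis by blast
qed

end

theory Submission
  imports Defs
begin

text \<open>
  Put \<open>\<psi>(z) = (\<Sum>n. q\<^bsup>n\<^sup>2\<^esup> z\<^sup>n / (q;q)\<^sub>n\<^sup>2)\<close>. For \<open>\<bar>x\<bar> < 1\<close>, the Heine-type identity
  \<open>(x;q)\<^sub>\<infinity> (\<Sum>k. x\<^sup>k / (q;q)\<^sub>k\<^sup>2) = \<psi>(x)\<close> and an exchange of summations turn the operator into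
  \<open>(q;q)\<^sub>\<infinity> (\<Sum>j. f(q\<^sup>j) q\<^sup>j / (q;q)\<^sub>j \<cdot> (x;q)\<^sub>j \<psi>(x q\<^sup>j))\<close>, which converges locally uniformly on the
  whole plane and hence is the entire extension. The functional equation
  \<open>\<psi>(y) = 2 \<psi>(qy) - (1 - qy) \<psi>(q\<^sup>2y)\<close> gives \<open>(1 + y) \<psi>(y) \<le> C (-y;q)\<^sub>\<infinity>\<close> for \<open>y \<ge> 0\<close>. Since
  \<open>(-r;q)\<^sub>j (-r q\<^sup>j;q)\<^sub>\<infinity> = (-r;q)\<^sub>\<infinity>\<close>, the maximum modulus on the disc of radius \<open>r\<close> is bounded by a multiple of
  \<open>(-r;q)\<^sub>\<infinity> (\<Sum>j. q\<^sup>j / (1 + r q\<^sup>j))\<close>, and \<open>q\<^sup>j / (1 + r q\<^sup>j) \<le> q\<^bsup>j/2\<^esup> / \<surd>r\<close>.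
\<close>

section \<open>Finite q-Pochhammer symbols\<close>

lemma qpoch_0 [simp]: "qpoch a q 0 = 1"
  by (simp add: qpoch_def)

lemma qpoch_Suc: "qpoch a q (Suc n) = qpoch a q n * (1 - a * q ^ n)"
  by (simp add: qpoch_def)

lemma qpoch_add: "qpoch a q (m + n) = qpoch a q m * qpoch (a * q ^ m) q n"
  by (induction n) (simp_all add: qpoch_Suc power_add mult_ac)

lemma of_real_qpoch:
  "qpoch (of_real a) (of_real q) n = (of_real (qpoch a q n) :: 'a :: real_normed_field)"
  by (simp add: qpoch_def)

lemma norm_qpoch_le:
  fixes z :: complex and q :: real
  assumes "0 \<le> q" "norm z \<le> r"
  shows "norm (qpoch z (of_real q) n) \<le> qpoch (- r) q n"
  unfolding qpoch_def prod_norm [symmetric]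
proof (rule prod_mono, safe)
  fix j
  have "norm (1 - z * of_real q ^ j) \<le> 1 + norm z * q ^ j"
    using norm_triangle_ineq4 [of 1 "z * of_real q ^ j"] assms
    by (simp add: norm_mult norm_power)
  also have "\<dots> \<le> 1 + r * q ^ j"
    using assms by (simp add: mult_right_mono)
  finally show "norm (1 - z * of_real q ^ j) \<le> 1 - - r * q ^ j" by simp
qed auto

text \<open>The product majorant makes the family absolutely summable over all pairs, so Fubini for
  unordered sums applies.\<close>

lemma suminf_swap_product_bound:
  fixes h :: "nat \<Rightarrow> nat \<Rightarrow> 'a :: banach"
  assumes bound: "\<And>i j. norm (h i j) \<le> a i * b j"
    and a: "summable a" "\<And>i. 0 \<le> a i" and b: "summable b" "\<And>j. 0 \<le> b j"
  shows "(\<Sum>i. \<Sum>j. h i j) = (\<Sum>j. \<Sum>i. h i j)"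
proof -
  have sum_eq: "infsum g UNIV = suminf g" if "summable (\<lambda>n. norm (g n))" for g :: "nat \<Rightarrow> 'a"
    using that by (metis infsumI norm_summable_imp_has_sum summable_norm_cancel summable_sums)
  have sb: "b summable_on UNIV" and sa: "a summable_on UNIV"
    using a b by (auto intro: norm_summable_imp_summable_on)
  have sab: "(\<lambda>(i, j). a i * b j) summable_on UNIV \<times> UNIV"
    using summable_on_SigmaI [where A = UNIV and B = "\<lambda>_. UNIV" and f = "\<lambda>(i, j). a i * b j"
        and g = "\<lambda>i. a i * infsum b UNIV"]
      sa sb a b
    by (auto intro!: has_sum_cmult_right has_sum_infsum summable_on_cmult_left)
  then have "(\<lambda>p. norm (case p of (i, j) \<Rightarrow> a i * b j)) summable_on UNIV \<times> UNIV"
    using a b by (simp add: case_prod_unfold)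
  then have "(\<lambda>(i, j). h i j) abs_summable_on UNIV \<times> UNIV"
    by (rule Infinite_Sum.abs_summable_on_comparison_test') (auto intro: order_trans [OF bound abs_ge_self])
  then have swap: "(\<Sum>\<^sub>\<infinity>i. \<Sum>\<^sub>\<infinity>j. h i j) = (\<Sum>\<^sub>\<infinity>j. \<Sum>\<^sub>\<infinity>i. h i j)"
    by (intro infsum_swap_banach) (rule abs_summable_summable)
  \<comment> \<open>\<open>sum_eq\<close> identifies an unordered sum with \<open>suminf\<close>
    only under absolute convergence, which is therefore checked for rows, columns and both outer
    sums.\<close>
  have rows: "summable (\<lambda>j. norm (h i j))" for i
    by (rule summable_comparison_test' [OF summable_mult [OF b(1), of "a i"]]) (simp add: bound)
  have cols: "summable (\<lambda>i. norm (h i j))" for j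
    by (rule summable_comparison_test' [OF summable_mult2 [OF a(1), of "b j"]]) (simp add: bound)
  have "norm (\<Sum>j. h i j) \<le> a i * suminf b" for i
  proof -
    have "norm (\<Sum>j. h i j) \<le> (\<Sum>j. norm (h i j))" by (rule summable_norm [OF rows])
    also have "\<dots> \<le> (\<Sum>j. a i * b j)"
      by (intro suminf_le bound rows summable_mult b)
    finally show ?thesis by (simp add: suminf_mult b)
  qed
  then have "summable (\<lambda>i. norm (\<Sum>j. h i j))"
    by (intro summable_comparison_test' [OF summable_mult2 [OF a(1), of "suminf b"]]) simp
  moreover have "norm (\<Sum>i. h i j) \<le> suminf a * b j" for j
  proof -
    have "norm (\<Sum>i. h i j) \<le> (\<Sum>i. norm (h i j))" by (rule summable_norm [OF cols])
    also have "\<dots> \<le> (\<Sum>i. a i * b j)"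
      by (intro suminf_le bound cols summable_mult2 a)
    finally show ?thesis by (simp add: suminf_mult2 a)
  qed
  then have "summable (\<lambda>j. norm (\<Sum>i. h i j))"
    by (intro summable_comparison_test' [OF summable_mult [OF b(1), of "suminf a"]]) simp
  ultimately show ?thesis using swap by (simp add: sum_eq rows cols)
qed

section \<open>The auxiliary series and the candidate for the entire extension\<close>

definition psi_coeff :: "real \<Rightarrow> nat \<Rightarrow> real" where
  "psi_coeff q n = q ^ (n ^ 2) / (qpoch q q n) ^ 2"

text \<open>In basic hypergeometric notation this is 0phi1(-; q; q, qz), that is, Jackson's second
  q-Bessel function of order zero with z = -x^2/4. The type is left open so that the complex
  function and its real majorant share one definition.\<close>

definition qpsi :: "real \<Rightarrow> 'a :: {real_normed_field, banach} \<Rightarrow> 'a" where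
  "qpsi q z = (\<Sum>n. of_real (psi_coeff q n) * z ^ n)"

text \<open>Splitting (z;q)_inf into (z;q)_j and (z q^j;q)_inf and absorbing the latter into
  \<open>qpsi\<close> leaves a polynomial times an entire function, so the restriction to |z| < 1
  disappears.\<close>

definition durrmeyer_term :: "real \<Rightarrow> (real \<Rightarrow> complex) \<Rightarrow> nat \<Rightarrow> complex \<Rightarrow> complex" where
  "durrmeyer_term q f j z =
     of_real (qpoch_inf q q * q ^ j / qpoch q q j) * f (q ^ j) * qpoch z (of_real q) j
       * qpsi q (z * of_real q ^ j)"

definition durrmeyer_series :: "real \<Rightarrow> (real \<Rightarrow> complex) \<Rightarrow> complex \<Rightarrow> complex" where
  "durrmeyer_series q f z = (\<Sum>j. durrmeyer_term q f j z)"

text \<open>Identity theorem, with 0 as a limit point of [0,1). The point 1 is left out because the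
  operator is given by its series only below 1.\<close>

lemma entire_eqI:
  assumes "F holomorphic_on UNIV" "G holomorphic_on UNIV"
    and "\<And>x. 0 \<le> x \<Longrightarrow> x < 1 \<Longrightarrow> F (of_real x) = G (of_real x)"
  shows "F = (G :: complex \<Rightarrow> complex)"
proof
  fix w
  have "0 islimpt (of_real ` {0..<1} :: complex set)"
    unfolding islimpt_approachable
  proof (intro allI impI)
    fix e :: real assume "0 < e"
    define x where "x = min (e / 2) (1 / 2)"
    have "0 < x" "x < 1" "x < e" using \<open>0 < e\<close> by (auto simp: x_def min_def)
    then show "\<exists>x'\<in>of_real ` {0..<1}. x' \<noteq> (0 :: complex) \<and> dist x' 0 < e"
      by (intro bexI [of _ "of_real x"]) auto
  qed
  then have "F w - G w = 0"
    using assms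
    by (intro analytic_continuation [of "\<lambda>z. F z - G z" UNIV "of_real ` {0..<1}" 0 w])
       (auto intro: holomorphic_on_diff)
  then show "F w = G w" by simp
qed

context
  fixes q :: real
  assumes q: "0 < q" "q < 1"
begin

section \<open>Infinite q-Pochhammer products\<close>

lemma qpoch_factor_pos: "a < 1 \<Longrightarrow> 0 < 1 - a * q ^ n"
proof -
  assume "a < 1"
  have "0 < q ^ n" "q ^ n \<le> 1" using q by (auto simp: power_le_one)
  show "0 < 1 - a * q ^ n"
  proof (cases "a \<le> 0")
    case True
    then have "a * q ^ n \<le> 0" using \<open>0 < q ^ n\<close> by (simp add: mult_le_0_iff)
    then show ?thesis by simp
  next
    case False
    then have "a * q ^ n \<le> a" using \<open>q ^ n \<le> 1\<close> by (simp add: mult_left_le)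
    then show ?thesis using \<open>a < 1\<close> by simp
  qed
qed

lemma qpoch_pos: "a < 1 \<Longrightarrow> 0 < qpoch a q n"
  unfolding qpoch_def by (intro prod_pos qpoch_factor_pos)

lemma convergent_prod_qpoch: "convergent_prod (\<lambda>j. 1 - a * q ^ j)"
proof (rule abs_convergent_prod_imp_convergent_prod)
  show "abs_convergent_prod (\<lambda>j. 1 - a * q ^ j)"
    unfolding abs_convergent_prod_conv_summable
    using q by (simp add: abs_mult power_abs summable_mult summable_geometric)
qed

lemma qpoch_tendsto: "(\<lambda>n. qpoch a q n) \<longlonglongrightarrow> qpoch_inf a q"
  using convergent_prod_LIMSEQ [OF convergent_prod_qpoch [of a]]
  unfolding qpoch_def qpoch_inf_def by (simp add: LIMSEQ_lessThan_iff_atMost)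

text \<open>A limit of positive partial products is nonnegative, and a convergent product without
  zero factors does not vanish.\<close>

lemma qpoch_inf_pos: "a < 1 \<Longrightarrow> 0 < qpoch_inf a q"
  using prodinf_nonzero [OF convergent_prod_qpoch [of a]] qpoch_factor_pos [of a]
    LIMSEQ_le_const [OF qpoch_tendsto [of a], of 0] qpoch_pos [of a]
  unfolding qpoch_inf_def by (metis less_eq_real_def order_less_irrefl)

lemma qpoch_inf_split: "qpoch_inf a q = qpoch a q n * qpoch_inf (a * q ^ n) q"
proof (rule LIMSEQ_unique)
  show "(\<lambda>m. qpoch a q (n + m)) \<longlonglongrightarrow> qpoch_inf a q"
    using LIMSEQ_ignore_initial_segment [OF qpoch_tendsto [of a], of n] by (simp add: add.commute)
  show "(\<lambda>m. qpoch a q (n + m)) \<longlonglongrightarrow> qpoch a q n * qpoch_inf (a * q ^ n) q"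
    unfolding qpoch_add by (intro tendsto_intros qpoch_tendsto)
qed

lemma qpoch_inf_rec: "qpoch_inf a q = (1 - a) * qpoch_inf (a * q) q"
  using qpoch_inf_split [of a 1] by (simp add: qpoch_Suc)

lemma qpoch_inf_le_1:
  assumes "0 \<le> a" "a < 1"
  shows "qpoch_inf a q \<le> 1"
proof (rule LIMSEQ_le_const2 [OF qpoch_tendsto])
  have "qpoch a q n \<le> 1" for n
    unfolding qpoch_def using assms q qpoch_factor_pos [OF assms(2)]
    by (intro prod_le_1) (auto intro: less_imp_le)
  then show "\<exists>N. \<forall>n\<ge>N. qpoch a q n \<le> 1" by blast
qed

lemma qpoch_inf_ge_1:
  assumes "0 \<le> r"
  shows "1 \<le> qpoch_inf (- r) q"
proof (rule LIMSEQ_le_const [OF qpoch_tendsto])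
  have "1 \<le> qpoch (- r) q n" for n
    unfolding qpoch_def using assms q by (intro prod_ge_1) auto
  then show "\<exists>N. \<forall>n\<ge>N. 1 \<le> qpoch (- r) q n" by blast
qed

lemma q_power_Suc_less_1: "q * q ^ n < 1"
  using q power_Suc_less_one [of q n] by simp

text \<open>The omitted tail is at most 1. This bounds the denominators (q;q)_n away from 0
  uniformly in \<open>n\<close>.\<close>

lemma qpoch_inf_le_qpoch: "qpoch_inf q q \<le> qpoch q q n"
proof -
  have "qpoch_inf (q * q ^ n) q \<le> 1"
    using q q_power_Suc_less_1 by (intro qpoch_inf_le_1) auto
  then show ?thesis
    using qpoch_inf_split [of q n] qpoch_pos [of q n] q by (simp add: mult_left_le)
qed

section \<open>Convergence and q-difference equation of the auxiliary series\<close>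

lemma psi_coeff_0 [simp]: "psi_coeff q 0 = 1"
  by (simp add: psi_coeff_def)

lemma psi_coeff_pos: "0 < psi_coeff q n"
  unfolding psi_coeff_def using q qpoch_pos [of q n] by simp

lemma psi_coeff_Suc: "(1 - q ^ Suc n) ^ 2 * psi_coeff q (Suc n) = q * q ^ (2 * n) * psi_coeff q n"
proof -
  have "(1 - q * q ^ n)\<^sup>2 \<noteq> 0"
    using q_power_Suc_less_1 [of n] by simp
  moreover have "(Suc n)\<^sup>2 = Suc (2 * n) + n\<^sup>2" by (simp add: power2_eq_square)
  then have "q ^ (Suc n)\<^sup>2 = q * q ^ (2 * n) * q ^ n\<^sup>2" by (simp add: power_add)
  ultimately show ?thesis
    unfolding psi_coeff_def qpoch_Suc power_mult_distrib by simp
qed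

lemma psi_summable_real:
  fixes r :: real
  shows "summable (\<lambda>n. psi_coeff q n * r ^ n)"
proof -
  \<comment> \<open>\<open>?C * q^(2n)\<close> bounds the ratio of consecutive terms, by
    \<open>psi_coeff_Suc\<close> and 1 - q^(n+1) \<ge> 1 - q. It tends to 0, so the radius of
    convergence is infinite.\<close>
  let ?C = "\<bar>r\<bar> * q / (1 - q) ^ 2"
  have "(\<lambda>n. ?C * (q ^ n * q ^ n)) \<longlonglongrightarrow> ?C * (0 * 0)"
    by (intro tendsto_intros LIMSEQ_power_zero) (use q in auto)
  then have "\<forall>\<^sub>F n in sequentially. ?C * (q ^ n * q ^ n) < 1/2"
    by (intro order_tendstoD) auto
  then obtain N where N: "\<And>n. n \<ge> N \<Longrightarrow> ?C * (q ^ n * q ^ n) < 1/2"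
    unfolding eventually_sequentially by blast
  show ?thesis
  proof (rule summable_ratio_test [of "1/2" N])
    fix n assume "n \<ge> N"
    have "(1 - q)\<^sup>2 \<le> (1 - q ^ Suc n)\<^sup>2"
      using q q_power_Suc_less_1 [of n] by (intro power_mono) (auto simp: mult_left_le power_le_one)
    then have "(1 - q)\<^sup>2 * psi_coeff q (Suc n) \<le> (1 - q ^ Suc n)\<^sup>2 * psi_coeff q (Suc n)"
      using psi_coeff_pos [of "Suc n"] by (intro mult_right_mono) auto
    then have "psi_coeff q (Suc n) \<le> q * q ^ (2 * n) / (1 - q)\<^sup>2 * psi_coeff q n"
      unfolding psi_coeff_Suc using q by (simp add: field_simps)
    then have "psi_coeff q (Suc n) * \<bar>r\<bar> ^ Suc n
        \<le> (q * q ^ (2 * n) / (1 - q)\<^sup>2 * psi_coeff q n) * \<bar>r\<bar> ^ Suc n"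
      by (intro mult_right_mono) auto
    also have "\<dots> = (?C * (q ^ n * q ^ n)) * (psi_coeff q n * \<bar>r\<bar> ^ n)"
      by (simp add: power_mult power2_eq_square power_mult_distrib mult_ac mult_2 power_add)
    also have "\<dots> \<le> 1/2 * (psi_coeff q n * \<bar>r\<bar> ^ n)"
      using N [OF \<open>n \<ge> N\<close>] psi_coeff_pos [of n] by (intro mult_right_mono) auto
    finally show "norm (psi_coeff q (Suc n) * r ^ Suc n) \<le> 1/2 * norm (psi_coeff q n * r ^ n)"
      using psi_coeff_pos by (simp add: abs_mult power_abs abs_of_pos)
  qed simp
qed

lemma psi_summable_norm:
  fixes z :: "'a :: {real_normed_field, banach}"
  shows "summable (\<lambda>n. norm (of_real (psi_coeff q n) * z ^ n))"
  using psi_summable_real [of "norm z"] psi_coeff_pos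
  by (simp add: norm_mult norm_power abs_of_pos)

lemma qpsi_of_real: "qpsi q (of_real x :: 'a :: {real_normed_field, banach}) = of_real (qpsi q x)"
  unfolding qpsi_def using suminf_of_real [OF psi_summable_real [of x], where 'a = 'a] by simp

lemma norm_qpsi_le:
  fixes z :: "'a :: {real_normed_field, banach}"
  assumes "norm z \<le> r"
  shows "norm (qpsi q z) \<le> qpsi q r"
proof -
  have "norm (qpsi q z) \<le> (\<Sum>n. norm (of_real (psi_coeff q n) * z ^ n))"
    unfolding qpsi_def by (rule summable_norm [OF psi_summable_norm])
  also have "\<dots> \<le> (\<Sum>n. psi_coeff q n * r ^ n)"
    using assms psi_coeff_pos [THEN less_imp_le]
    by (intro suminf_le psi_summable_norm psi_summable_real)
       (auto simp: norm_mult norm_power intro!: mult_left_mono power_mono)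
  finally show ?thesis by (simp add: qpsi_def)
qed

lemma qpsi_nonneg: "0 \<le> r \<Longrightarrow> 0 \<le> qpsi q (r :: real)"
  using norm_qpsi_le [of "r" r] by simp

text \<open>Applying (1 - S)^2, where S is the dilation y -> qy, multiplies the n-th coefficient by
  (1 - q^n)^2; \<open>psi_coeff_Suc\<close> turns the result into a shifted copy of the series at
  q^2 y.\<close>

lemma qpsi_functional_equation:
  fixes y :: real
  shows "qpsi q y = 2 * qpsi q (q * y) - (1 - q * y) * qpsi q (q\<^sup>2 * y)"
proof -
  let ?b = "psi_coeff q"
  have sums: "(\<lambda>n. ?b n * x ^ n) sums qpsi q x" for x
    unfolding qpsi_def using psi_summable_real [of x] by (simp add: summable_sums)
  let ?d = "\<lambda>n. ?b n * y ^ n - 2 * (?b n * (q * y) ^ n) + ?b n * (q\<^sup>2 * y) ^ n"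
  have "?d sums (qpsi q y - 2 * qpsi q (q * y) + qpsi q (q\<^sup>2 * y))"
    by (intro sums_add sums_diff sums_mult sums)
  moreover have "?d sums (q * y * qpsi q (q\<^sup>2 * y))"
  proof -
    have "?d (Suc n) = q * y * (?b n * (q\<^sup>2 * y) ^ n)" for n
    proof -
      have "?d (Suc n) = ((1 - q ^ Suc n) ^ 2 * ?b (Suc n)) * y ^ Suc n"
        by (simp add: algebra_simps power2_eq_square power_mult_distrib)
      also have "\<dots> = q * y * (?b n * (q\<^sup>2 * y) ^ n)"
        unfolding psi_coeff_Suc power_mult by (simp add: power_mult_distrib mult_ac)
      finally show ?thesis .
    qed
    then have "(\<lambda>n. ?d (Suc n)) sums (q * y * qpsi q (q\<^sup>2 * y))"
      using sums_mult [OF sums [of "q\<^sup>2 * y"], of "q * y"] by simp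
    \<comment> \<open>The index shift costs nothing: the term of \<open>?d\<close> at 0 is 1 - 2 + 1
      = 0.\<close>
    then show ?thesis by (subst (asm) sums_Suc_iff) simp
  qed
  ultimately have "qpsi q y - 2 * qpsi q (q * y) + qpsi q (q\<^sup>2 * y) = q * y * qpsi q (q\<^sup>2 * y)"
    by (rule sums_unique2)
  then show ?thesis by (simp add: algebra_simps)
qed

subsection \<open>Growth of \<open>\<psi>\<close> and Heine's transformation\<close>

lemma qpsi_mono:
  fixes x y :: real
  assumes "0 \<le> x" "x \<le> y"
  shows "qpsi q x \<le> qpsi q y"
  using norm_qpsi_le [of x y] qpsi_nonneg [of x] assms by simp

text \<open>The functional equation gives the bound \<open>3 * B * ?P\<close>, where the 3 counts 2
  from the first term and 1 from the second, since (1 + qy) \<open>?Q\<close> = \<open>?P\<close>.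
  The factor 1 + y is gained because \<open>?P\<close> is the product for -y without its first
  factor.\<close>

lemma qpsi_ratio_step:
  fixes y B :: real
  assumes y: "0 \<le> y"
    and B: "qpsi q (q * y) \<le> B * qpoch_inf (- (q * y)) q"
      "qpsi q (q\<^sup>2 * y) \<le> B * qpoch_inf (- (q\<^sup>2 * y)) q"
  shows "(1 + y) * qpsi q y \<le> 3 * B * qpoch_inf (- y) q"
proof -
  let ?P = "qpoch_inf (- (q * y)) q" and ?Q = "qpoch_inf (- (q\<^sup>2 * y)) q"
  have P: "?P = (1 + q * y) * ?Q" and R: "qpoch_inf (- y) q = (1 + y) * ?P"
    using qpoch_inf_rec [of "- (q * y)"] qpoch_inf_rec [of "- y"]
    by (simp_all add: power2_eq_square mult_ac)
  have Q: "1 \<le> ?Q" using qpoch_inf_ge_1 [of "q\<^sup>2 * y"] y by simp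
  have "0 \<le> B * ?Q" using B(2) qpsi_nonneg [of "q\<^sup>2 * y"] y by simp
  have "qpsi q y \<le> 2 * qpsi q (q * y) + (q * y) * qpsi q (q\<^sup>2 * y)"
    using qpsi_functional_equation [of y] qpsi_nonneg [of "q\<^sup>2 * y"] y
    by (simp add: algebra_simps)
  also have "\<dots> \<le> 2 * (B * ?P) + (q * y) * (B * ?Q)"
    using B y q by (intro add_mono mult_left_mono) auto
  also have "\<dots> \<le> 2 * (B * ?P) + (1 + q * y) * (B * ?Q)"
    using \<open>0 \<le> B * ?Q\<close> by (simp add: mult_right_mono distrib_right)
  also have "\<dots> = 3 * B * ?P" by (simp add: P algebra_simps)
  finally have "(1 + y) * qpsi q y \<le> (1 + y) * (3 * B * ?P)"
    using y by (intro mult_left_mono) auto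
  then show ?thesis by (simp add: R mult_ac)
qed

text \<open>Induction on the number of dilations by \<open>q\<close> that bring \<open>y\<close>
  down to at most 2. Beyond 2 the factor 3/(1 + y) from \<open>qpsi_ratio_step\<close> is below 1,
  so the constant does not grow; this is the origin of the threshold 2.\<close>

lemma qpsi_le_qpoch_inf:
  fixes y :: real
  assumes "0 \<le> y"
  shows "qpsi q y \<le> qpsi q 2 * qpoch_inf (- y) q"
proof -
  have main: "qpsi q y \<le> qpsi q 2 * qpoch_inf (- y) q" if "0 \<le> y" "q ^ n * y \<le> 2" for y n
    using that
  proof (induction n arbitrary: y)
    case 0
    then have "qpsi q y \<le> qpsi q 2 * 1" by (simp add: qpsi_mono)
    also have "\<dots> \<le> qpsi q 2 * qpoch_inf (- y) q"
      using 0 by (intro mult_left_mono qpoch_inf_ge_1 qpsi_nonneg) auto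
    finally show ?case .
  next
    case (Suc n)
    show ?case
    proof (cases "y \<le> 2")
      case True
      then have "qpsi q y \<le> qpsi q 2 * 1" using Suc.prems by (simp add: qpsi_mono)
      also have "\<dots> \<le> qpsi q 2 * qpoch_inf (- y) q"
        using Suc.prems by (intro mult_left_mono qpoch_inf_ge_1 qpsi_nonneg) auto
      finally show ?thesis .
    next
      case False
      have "q ^ n * (q * y) \<le> 2" using Suc.prems by (simp add: mult_ac)
      moreover have "q * (q ^ n * (q * y)) \<le> 1 * (q ^ n * (q * y))"
        using q Suc.prems by (intro mult_right_mono) auto
      then have "q ^ n * (q\<^sup>2 * y) \<le> q ^ n * (q * y)"
        by (simp add: power2_eq_square mult_ac)
      ultimately have "q ^ n * (q * y) \<le> 2" "q ^ n * (q\<^sup>2 * y) \<le> 2" by linarith+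
      then have "(1 + y) * qpsi q y \<le> 3 * qpsi q 2 * qpoch_inf (- y) q"
        using Suc.prems q by (intro qpsi_ratio_step Suc.IH) auto
      moreover have "3 * qpsi q y \<le> (1 + y) * qpsi q y"
        using False by (intro mult_right_mono qpsi_nonneg) auto
      ultimately show ?thesis by simp
    qed
  qed
  have "(\<lambda>n. q ^ n * y) \<longlonglongrightarrow> 0 * y"
    by (intro tendsto_intros LIMSEQ_power_zero) (use q in auto)
  then have "\<forall>\<^sub>F n in sequentially. q ^ n * y < 2" by (intro order_tendstoD) auto
  then obtain n where "q ^ n * y < 2" by (auto simp: eventually_sequentially)
  with main [of y n] assms show ?thesis by simp
qed

text \<open>One further ratio step on top of the global bound. The gained 1/(1 + y) is what later
  yields little-o instead of big-O.\<close>

lemma qpsi_decay: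
  fixes y :: real
  assumes "0 \<le> y"
  shows "(1 + y) * qpsi q y \<le> 3 * qpsi q 2 * qpoch_inf (- y) q"
  using assms q by (intro qpsi_ratio_step qpsi_le_qpoch_inf) auto

section \<open>Euler's q-exponential series and Heine's transformation\<close>

lemma summable_geometric_over_qpoch:
  fixes x :: real
  assumes "\<bar>x\<bar> < 1"
  shows "summable (\<lambda>n. norm (x ^ n / qpoch q q n ^ m))"
proof (rule summable_comparison_test')
  let ?c = "qpoch_inf q q"
  show "summable (\<lambda>n. (1 / ?c ^ m) * \<bar>x\<bar> ^ n)"
    using assms by (intro summable_mult summable_geometric) simp
  fix n
  have "0 < ?c" "?c \<le> qpoch q q n"
    using q qpoch_inf_pos [of q] qpoch_inf_le_qpoch by auto
  then have "1 / qpoch q q n ^ m \<le> 1 / ?c ^ m"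
    by (intro divide_left_mono power_mono) auto
  then have "(1 / qpoch q q n ^ m) * \<bar>x\<bar> ^ n \<le> (1 / ?c ^ m) * \<bar>x\<bar> ^ n"
    by (intro mult_right_mono) auto
  then show "norm (norm (x ^ n / qpoch q q n ^ m)) \<le> (1 / ?c ^ m) * \<bar>x\<bar> ^ n"
    using qpoch_pos [of q n] q by (simp add: power_abs abs_of_pos)
qed

text \<open>Euler's identity: the series satisfies E(y)(1 - y) = E(qy). Iterating gives E(x)(x;q)_n
  = E(x q^n), and continuity at 0 lets \<open>n\<close> tend to infinity.\<close>

lemma q_exponential_sum:
  fixes x :: real
  assumes "\<bar>x\<bar> < 1"
  shows "(\<Sum>n. x ^ n / qpoch q q n) * qpoch_inf x q = 1"
proof -
  let ?E = "\<lambda>x. \<Sum>n. x ^ n / qpoch q q n"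
  have sm: "summable (\<lambda>n. y ^ n / qpoch q q n)" if "\<bar>y\<bar> < 1" for y
    using summable_geometric_over_qpoch [OF that, of 1] unfolding power_one_right by (rule summable_norm_cancel)
  have rec: "?E y * (1 - y) = ?E (y * q)" if "\<bar>y\<bar> < 1" for y
  proof -
    have yq: "\<bar>y * q\<bar> < 1"
      using that q by (simp add: abs_mult) (metis abs_ge_zero less_imp_le mult_left_le order_le_less_trans)
    have E: "(\<lambda>n. z ^ n / qpoch q q n) sums ?E z" if "\<bar>z\<bar> < 1" for z
      using sm [OF that] by (rule summable_sums)
    let ?d = "\<lambda>n. y ^ n / qpoch q q n - (y * q) ^ n / qpoch q q n"
    have "?d sums (?E y - ?E (y * q))"
      by (intro sums_diff E that yq)
    moreover have "?d (Suc n) = y * (y ^ n / qpoch q q n)" for n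
    proof -
      have "1 - q * q ^ n \<noteq> 0" "qpoch q q n \<noteq> 0"
        using q_power_Suc_less_1 [of n] qpoch_pos [of q n] q by auto
      then show ?thesis
        by (simp add: qpoch_Suc divide_simps power_mult_distrib) (simp add: algebra_simps)
    qed
    then have "(\<lambda>n. ?d (Suc n)) sums (y * ?E y)"
      using sums_mult [OF E [OF that], of y] by simp
    then have "?d sums (y * ?E y)" by (subst (asm) sums_Suc_iff) simp
    ultimately have "?E y - ?E (y * q) = y * ?E y" by (rule sums_unique2)
    then show ?thesis by (simp add: algebra_simps)
  qed
  have iter: "?E x * qpoch x q n = ?E (x * q ^ n)" for n
  proof (induction n)
    case (Suc n)
    have "\<bar>x * q ^ n\<bar> \<le> \<bar>x\<bar>"
      using q by (simp add: abs_mult power_abs mult_left_le power_le_one)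
    then have "?E (x * q ^ n) * (1 - x * q ^ n) = ?E (x * q ^ n * q)"
      using assms by (intro rec) simp
    then show ?case by (simp add: qpoch_Suc Suc.IH [symmetric] mult_ac)
  qed simp
  have "isCont (\<lambda>y. \<Sum>n. (1 / qpoch q q n) * y ^ n) 0"
    using sm [of "1/2"] by (intro isCont_powser [of _ "1/2"]) auto
  then have "isCont ?E 0" by simp
  moreover have "(\<lambda>n. x * q ^ n) \<longlonglongrightarrow> x * 0"
    by (intro tendsto_intros LIMSEQ_power_zero) (use q in auto)
  ultimately have "(\<lambda>n. ?E (x * q ^ n)) \<longlonglongrightarrow> ?E 0"
    by (intro isCont_tendsto_compose [of 0 ?E]) auto
  moreover have "?E 0 = 1"
    using powser_zero [of "\<lambda>n. 1 / qpoch q q n"] by simp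
  ultimately have "(\<lambda>n. ?E x * qpoch x q n) \<longlonglongrightarrow> 1" by (simp only: iter)
  moreover have "(\<lambda>n. ?E x * qpoch x q n) \<longlonglongrightarrow> ?E x * qpoch_inf x q"
    by (intro tendsto_intros qpoch_tendsto)
  ultimately show ?thesis by (rule LIMSEQ_unique [symmetric])
qed

text \<open>The right-hand sides are determined by \<open>(1 - X) \<chi> = 2 \<chi>(qX) - \<chi>(q\<^sup>2X)\<close> and \<open>\<chi>(0) = 1\<close>, an equation that
  the product of the two generating functions inherits from the functional equations of its factors.\<close>

lemma psi_coeff_convolution:
  "(\<Sum>i\<le>k. psi_coeff q i * (1 / qpoch q q (k - i))) = 1 / (qpoch q q k)\<^sup>2"
proof -
  \<comment> \<open>The dilation X -> qX is written as a composition, so that its multiplicativity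
    is a library fact.\<close>
  define S :: "real fps \<Rightarrow> real fps" where "S = (\<lambda>f. f oo (fps_const q * fps_X))"
  have S_nth: "fps_nth (S f) n = q ^ n * fps_nth f n" for f n
    unfolding S_def by simp
  have S_mult: "S (f * g) = S f * S g" for f g
    unfolding S_def by (rule fps_compose_mult_distrib) simp
  define P where "P = Abs_fps (psi_coeff q)"
  define E where "E = Abs_fps (\<lambda>n. 1 / qpoch q q n)"
  have E: "E - fps_X * E = S E"
  proof (rule fps_ext)
    fix n show "fps_nth (E - fps_X * E) n = fps_nth (S E) n"
    proof (cases n)
      case (Suc m)
      have "1 - q * q ^ m \<noteq> 0" "qpoch q q m \<noteq> 0"
        using q_power_Suc_less_1 [of m] qpoch_pos [of q m] q by auto
      then show ?thesis
        unfolding Suc by (simp add: S_nth E_def qpoch_Suc divide_simps)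
    qed (simp add: S_nth E_def)
  qed
  \<comment> \<open>Used with u = q^(m+1), v = q^m and two consecutive coefficients for
    \<open>b\<close> and \<open>c\<close>.\<close>
  have step: "b = u * b + u * b - u * (u * b) + q * (v * (v * c))"
    if "(1 - u)\<^sup>2 * b = q * (v * v) * c" for u v b c :: real
    using that by (simp add: power2_eq_square algebra_simps)
  have P: "P = S P + S P - S (S P) + fps_const q * fps_X * S (S P)"
  proof (rule fps_ext)
    fix n
    show "fps_nth P n = fps_nth (S P + S P - S (S P) + fps_const q * fps_X * S (S P)) n"
    proof (cases n)
      case (Suc m)
      have "(1 - q ^ Suc m)\<^sup>2 * psi_coeff q (Suc m) = q * (q ^ m * q ^ m) * psi_coeff q m"
        using psi_coeff_Suc [of m] by (simp only: mult_2 power_add)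
      then have "psi_coeff q (Suc m) = q ^ Suc m * psi_coeff q (Suc m) + q ^ Suc m * psi_coeff q (Suc m)
          - q ^ Suc m * (q ^ Suc m * psi_coeff q (Suc m)) + q * (q ^ m * (q ^ m * psi_coeff q m))"
        by (rule step)
      moreover have "fps_nth (fps_const q * fps_X * S (S P)) (Suc m) = q * (q ^ m * (q ^ m * psi_coeff q m))"
        by (simp add: S_nth P_def mult.assoc)
      ultimately show ?thesis
        unfolding Suc fps_add_nth fps_sub_nth S_nth by (simp only: P_def fps_nth_Abs_fps)
    qed (simp add: S_nth P_def mult.assoc)
  qed
  have SE: "S E - fps_const q * fps_X * S E = S (S E)"
  proof -
    have "S (E - fps_X * E) = S E - S (fps_X * E)"
      by (rule fps_ext) (simp only: S_nth fps_sub_nth right_diff_distrib)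
    moreover have "S fps_X = fps_const q * fps_X"
      unfolding S_def by (rule fps_X_fps_compose_startby0) simp
    ultimately show ?thesis by (simp only: S_mult E)
  qed
  define W where "W = P * E"
  have W: "W - fps_X * W = S W + S W - S (S W)"
  proof -
    have "W - fps_X * W = P * S E"
      unfolding W_def E [symmetric] by (simp only: right_diff_distrib mult_ac)
    \<comment> \<open>The term with \<open>fps_X\<close> is grouped with \<open>S (S P)\<close>, so
      that \<open>SE\<close> turns the bracket into \<open>S (S E)\<close>.\<close>
    also have "\<dots> = S P * S E + S P * S E - S (S P) * (S E - fps_const q * fps_X * S E)"
      by (subst P) algebra
    finally show ?thesis by (simp only: SE S_mult W_def)
  qed
  have rec: "(1 - q * q ^ n)\<^sup>2 * fps_nth W (Suc n) = fps_nth W n" for n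
  proof -
    have "fps_nth W (Suc n) - fps_nth W n = q ^ Suc n * fps_nth W (Suc n) + q ^ Suc n * fps_nth W (Suc n)
        - q ^ Suc n * (q ^ Suc n * fps_nth W (Suc n))"
      using arg_cong [OF W, of "\<lambda>f. fps_nth f (Suc n)"] by (simp add: S_nth)
    then show ?thesis by (simp add: power2_eq_square algebra_simps)
  qed
  have "fps_nth W k = 1 / (qpoch q q k)\<^sup>2"
  proof (induction k)
    case 0
    show ?case by (simp add: W_def P_def E_def)
  next
    case (Suc n)
    have "(1 - q * q ^ n)\<^sup>2 \<noteq> 0" using q_power_Suc_less_1 [of n] by simp
    then have "fps_nth W (Suc n) = fps_nth W n / (1 - q * q ^ n)\<^sup>2"
      using rec [of n] by (simp add: nonzero_eq_divide_eq mult.commute)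
    then show ?case unfolding Suc by (simp add: qpoch_Suc power_mult_distrib)
  qed
  then show ?thesis
    by (simp add: fps_mult_nth W_def P_def E_def atLeast0AtMost)
qed

text \<open>By \<open>psi_coeff_convolution\<close>, the Cauchy product of \<open>qpsi\<close> with
  Euler's series for 1/(x;q)_inf has coefficients 1/(q;q)_k^2; multiplying by (x;q)_inf removes
  Euler's series.\<close>

lemma qpsi_eq:
  fixes x :: real
  assumes "\<bar>x\<bar> < 1"
  shows "qpoch_inf x q * (\<Sum>k. x ^ k / (qpoch q q k)\<^sup>2) = qpsi q x"
proof -
  have inner: "(\<Sum>i\<le>k. (psi_coeff q i * x ^ i) * (x ^ (k - i) / qpoch q q (k - i)))
      = x ^ k / (qpoch q q k)\<^sup>2" for k
  proof -
    have "(\<Sum>i\<le>k. (psi_coeff q i * x ^ i) * (x ^ (k - i) / qpoch q q (k - i)))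
        = (\<Sum>i\<le>k. x ^ k * (psi_coeff q i * (1 / qpoch q q (k - i))))"
    proof (rule sum.cong)
      fix i assume "i \<in> {..k}"
      then have "x ^ k = x ^ i * x ^ (k - i)" by (simp flip: power_add)
      then show "(psi_coeff q i * x ^ i) * (x ^ (k - i) / qpoch q q (k - i))
          = x ^ k * (psi_coeff q i * (1 / qpoch q q (k - i)))" by simp
    qed simp
    then show ?thesis by (simp only: sum_distrib_left [symmetric] psi_coeff_convolution) simp
  qed
  have "qpsi q x * (\<Sum>k. x ^ k / qpoch q q k)
      = (\<Sum>k. \<Sum>i\<le>k. (psi_coeff q i * x ^ i) * (x ^ (k - i) / qpoch q q (k - i)))"
    using psi_summable_norm [of x] summable_geometric_over_qpoch [OF assms, of 1]
    unfolding qpsi_def by (subst Cauchy_product) simp_all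
  then have "qpsi q x * (\<Sum>k. x ^ k / qpoch q q k) = (\<Sum>k. x ^ k / (qpoch q q k)\<^sup>2)"
    unfolding inner .
  then show ?thesis using q_exponential_sum [OF assms]
    by (metis mult.assoc mult.commute mult.right_neutral)
qed

subsection \<open>Entire extension\<close>

lemma q_power_in_unit: "q ^ n \<in> {0..1}"
  using q by (simp add: power_le_one)

lemma qpoch_inf_q_power_Suc: "qpoch_inf (q * q ^ j) q = qpoch_inf q q / qpoch q q j"
  using qpoch_inf_split [of q j] qpoch_pos [of q j] q by simp

lemma summable_q_power_over_qpoch: "summable (\<lambda>j. q ^ j / qpoch q q j)"
proof -
  have "norm (q ^ j / qpoch q q j) = q ^ j / qpoch q q j" for j
    using qpoch_pos [of q j] q by simp
  then show ?thesis
    using summable_geometric_over_qpoch [of q 1] q by simp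
qed

text \<open>In the q-integrand (q^(j+1);q)_inf = (q;q)_inf/(q;q)_j, and q^(-k) cancels against the
  power of \<open>q\<close> in (q q^j)^k; boundedness of \<open>f\<close> gives convergence.\<close>

lemma A_inf_sums:
  assumes f: "\<And>x. x \<in> {0..1} \<Longrightarrow> norm (f x) \<le> K"
  shows "(\<lambda>j. (qpoch_inf q q / qpoch q q k * (q * q ^ k) ^ j / qpoch q q j) *\<^sub>R f (q ^ j)) sums A_inf q k f"
proof -
  let ?t = "\<lambda>j. q ^ j *\<^sub>R (p_inf q k (q * (1 * q ^ j)) *\<^sub>R f (1 * q ^ j))"
  let ?c = "qpoch_inf q q / qpoch q q k"
  have t: "(1 / q ^ k) *\<^sub>R ?t j = (?c * (q * q ^ k) ^ j / qpoch q q j) *\<^sub>R f (q ^ j)" for j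
    using q by (simp add: p_inf_def qpoch_inf_q_power_Suc power_mult_distrib mult_ac
        flip: power_mult)
  have c: "0 < ?c" using qpoch_inf_pos [of q] qpoch_pos [of q k] q by simp
  have "summable (\<lambda>j. (1 / q ^ k) *\<^sub>R ?t j)"
  proof (rule summable_comparison_test')
    show "summable (\<lambda>j. ?c * K * (q ^ j / qpoch q q j))"
      by (intro summable_mult summable_q_power_over_qpoch)
    fix j
    have "(q * q ^ k) ^ j \<le> q ^ j"
      using q by (intro power_mono) (auto simp: mult_left_le power_le_one)
    then have "?c * ((q * q ^ k) ^ j / qpoch q q j) * norm (f (q ^ j)) \<le> ?c * (q ^ j / qpoch q q j) * K"
      using c q qpoch_pos [of q j] f [OF q_power_in_unit]
        mult_nonneg_nonneg [OF less_imp_le [OF c], of "q ^ j / qpoch q q j"]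
      by (intro mult_mono mult_left_mono divide_right_mono) (auto simp del: times_divide_eq_left times_divide_eq_right)
    moreover have "0 \<le> ?c * (q * q ^ k) ^ j / qpoch q q j"
      using qpoch_inf_pos [of q] qpoch_pos [of q j] qpoch_pos [of q k] q by simp
    ultimately show "norm ((1 / q ^ k) *\<^sub>R ?t j) \<le> ?c * K * (q ^ j / qpoch q q j)"
      unfolding t norm_scaleR real_norm_def by (simp only: abs_of_nonneg) (simp add: mult_ac)
  qed
  then have "summable (\<lambda>j. q ^ k *\<^sub>R ((1 / q ^ k) *\<^sub>R ?t j))"
    by (rule summable_scaleR_right)
  then have "summable ?t" using q by simp
  then have "(\<lambda>j. (1 / q ^ k) *\<^sub>R ?t j) sums ((1 / q ^ k) *\<^sub>R (\<Sum>j. ?t j))"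
    by (intro sums_scaleR_right summable_sums)
  moreover have "A_inf q k f = (1 / q ^ k) *\<^sub>R (\<Sum>j. ?t j)"
    using q by (simp add: A_inf_def q_integral_def power_int_minus divide_inverse)
  ultimately show ?thesis by (simp only: t)
qed

lemma qpoch_inf_term_le_1: "qpoch_inf q q / qpoch q q j \<le> 1"
  using qpoch_inf_le_qpoch [of j] qpoch_pos [of q j] q by simp

text \<open>The Pochhammer factor is largest at z = -r and \<open>qpsi\<close> at the positive
  radius. Their bounds recombine to (-r;q)_inf for every \<open>j\<close>, and
  \<open>qpsi_decay\<close> supplies the extra denominator.\<close>

lemma norm_durrmeyer_term_le:
  assumes f: "\<And>x. x \<in> {0..1} \<Longrightarrow> norm (f x) \<le> K" and z: "norm z \<le> r"
  shows "norm (durrmeyer_term q f j z)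
    \<le> 3 * K * qpsi q 2 * qpoch_inf (- r) q * (q ^ j / (1 + r * q ^ j))"
proof -
  have r: "0 \<le> r" using z norm_ge_zero by (rule order_trans [rotated])
  have K: "0 \<le> K" using f [of 0] norm_ge_zero [of "f 0"] by (simp del: norm_ge_zero)
  let ?y = "r * q ^ j"
  have y: "0 \<le> ?y" using r q by simp
  have pos: "0 < qpoch q q j" "0 < qpoch_inf q q"
    using qpoch_pos [of q j] qpoch_inf_pos [of q] q by auto
  have P: "0 < qpoch (- r) q j" using r by (intro qpoch_pos) simp
  have "norm (z * of_real q ^ j) \<le> ?y"
    using z q by (simp add: norm_mult norm_power mult_right_mono)
  then have "norm (qpsi q (z * of_real q ^ j)) \<le> qpsi q ?y" by (rule norm_qpsi_le)
  also have "qpsi q ?y \<le> 3 * qpsi q 2 * qpoch_inf (- ?y) q / (1 + ?y)"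
    using qpsi_decay [OF y] y by (simp add: pos_le_divide_eq mult_ac)
  finally have psi: "norm (qpsi q (z * of_real q ^ j)) \<le> 3 * qpsi q 2 * qpoch_inf (- ?y) q / (1 + ?y)" .
  have "qpoch_inf q q / qpoch q q j * q ^ j \<le> 1 * q ^ j"
    using q by (intro mult_right_mono qpoch_inf_term_le_1) auto
  then have c: "norm (of_real (qpoch_inf q q * q ^ j / qpoch q q j) :: complex) \<le> q ^ j"
    using pos q by (simp only: norm_of_real) simp
  have "norm (durrmeyer_term q f j z)
    \<le> q ^ j * K * qpoch (- r) q j * (3 * qpsi q 2 * qpoch_inf (- ?y) q / (1 + ?y))"
    unfolding durrmeyer_term_def norm_mult
    using q K P c psi f [OF q_power_in_unit] norm_qpoch_le [of q z r j] z
    by (intro mult_mono) (auto simp: norm_mult)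
  also have "\<dots> = 3 * K * qpsi q 2 * (qpoch (- r) q j * qpoch_inf (- r * q ^ j) q) * (q ^ j / (1 + ?y))"
    by simp
  also have "\<dots> = 3 * K * qpsi q 2 * qpoch_inf (- r) q * (q ^ j / (1 + ?y))"
    by (simp only: qpoch_inf_split [of "- r" j])
  finally show ?thesis .
qed

lemma holomorphic_qpsi: "qpsi q holomorphic_on (UNIV :: complex set)"
proof (rule holomorphic_onI)
  fix z :: complex
  have "((\<lambda>z. \<Sum>n. of_real (psi_coeff q n) * z ^ n) has_field_derivative
      (\<Sum>n. diffs (\<lambda>n. of_real (psi_coeff q n)) n * z ^ n)) (at z)"
    by (rule termdiffs_strong_converges_everywhere)
       (rule summable_norm_cancel [OF psi_summable_norm])
  then show "qpsi q field_differentiable at z within UNIV"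
    unfolding qpsi_def [abs_def] field_differentiable_def by auto
qed

lemma holomorphic_durrmeyer_term: "durrmeyer_term q f j holomorphic_on UNIV"
proof -
  have "(\<lambda>z. qpsi q (z * of_real q ^ j)) holomorphic_on (UNIV :: complex set)"
    using holomorphic_on_compose_gen [OF _ holomorphic_qpsi, of "\<lambda>z. z * of_real q ^ j" UNIV]
    by (simp add: o_def holomorphic_on_mult)
  then show ?thesis
    unfolding durrmeyer_term_def [abs_def] qpoch_def by (intro holomorphic_intros)
qed

lemma holomorphic_durrmeyer_series:
  assumes f: "\<And>x. x \<in> {0..1} \<Longrightarrow> norm (f x) \<le> K"
  shows "durrmeyer_series q f holomorphic_on UNIV"
proof (rule holomorphic_uniform_sequence [where f = "\<lambda>n z. \<Sum>j<n. durrmeyer_term q f j z"])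
  show "(\<lambda>z. \<Sum>j<n. durrmeyer_term q f j z) holomorphic_on UNIV" for n
    by (intro holomorphic_on_sum) (use holomorphic_durrmeyer_term in auto)
  fix z0 :: complex
  \<comment> \<open>Radius of a disc about 0 containing \<open>cball z0 1\<close>, which makes the
    majorant uniform there.\<close>
  define r where "r = norm z0 + 1"
  let ?C = "3 * K * qpsi q 2 * qpoch_inf (- r) q"
  have r: "0 \<le> r" by (simp add: r_def add_nonneg_nonneg)
  have K: "0 \<le> K" using f [of 0] norm_ge_zero [of "f 0"] by (simp del: norm_ge_zero)
  have C: "0 \<le> ?C"
    using K qpsi_nonneg [of 2] qpoch_inf_ge_1 [OF r] by simp
  have "uniform_limit (cball z0 1) (\<lambda>n z. \<Sum>j<n. durrmeyer_term q f j z)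
      (\<lambda>z. \<Sum>j. durrmeyer_term q f j z) sequentially"
  proof (rule Weierstrass_m_test)
    show "summable (\<lambda>j. ?C * q ^ j)"
      using q by (intro summable_mult summable_geometric) simp
    fix j z assume "z \<in> cball z0 1"
    then have "norm z \<le> r"
      using norm_triangle_ineq2 [of z z0] by (simp add: r_def dist_norm norm_minus_commute)
    then have "norm (durrmeyer_term q f j z) \<le> ?C * (q ^ j / (1 + r * q ^ j))"
      by (intro norm_durrmeyer_term_le f)
    also have "\<dots> \<le> ?C * (q ^ j / 1)"
      using C q r by (intro mult_left_mono divide_left_mono) (auto simp: add_pos_nonneg)
    finally show "norm (durrmeyer_term q f j z) \<le> ?C * q ^ j" by simp
  qed
  then show "\<exists>d. 0 < d \<and> cball z0 d \<subseteq> UNIV \<and>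
      uniform_limit (cball z0 d) (\<lambda>n z. \<Sum>j<n. durrmeyer_term q f j z) (durrmeyer_series q f) sequentially"
    unfolding durrmeyer_series_def [abs_def] by (intro exI [of _ 1]) simp
qed simp

text \<open>Insert the series of \<open>A_inf\<close>, exchange the sums and evaluate the sum over
  \<open>k\<close> by \<open>qpsi_eq\<close> at x q^j. The estimate (q q^k)^j \<le> q^j decouples
  the indices, giving the product majorant for the exchange.\<close>

lemma durrmeyer_series_of_real:
  assumes f: "\<And>x. x \<in> {0..1} \<Longrightarrow> norm (f x) \<le> K" and x: "0 \<le> x" "x < 1"
  shows "durrmeyer_series q f (of_real x) = (\<Sum>k. p_inf q k x *\<^sub>R A_inf q k f)"
proof -
  define h where "h = (\<lambda>k j. (qpoch_inf x q * x ^ k / qpoch q q k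
      * (qpoch_inf q q / qpoch q q k * (q * q ^ k) ^ j / qpoch q q j)) *\<^sub>R f (q ^ j))"
  define a where "a = (\<lambda>k. qpoch_inf x q * qpoch_inf q q * norm (x ^ k / qpoch q q k ^ 2))"
  define b where "b = (\<lambda>j. K * (q ^ j / qpoch q q j))"
  have K: "0 \<le> K" using f [of 0] norm_ge_zero [of "f 0"] by (simp del: norm_ge_zero)
  have pos: "0 < qpoch q q n" for n using qpoch_pos [of q n] q by simp
  have pinf: "0 < qpoch_inf x q" "0 < qpoch_inf q q"
    using qpoch_inf_pos q x by auto
  have bound: "norm (h k j) \<le> a k * b j" for k j
  proof -
    have "(q * q ^ k) ^ j \<le> q ^ j"
      using q by (intro power_mono) (auto simp: mult_left_le power_le_one)
    then have "a k * ((q * q ^ k) ^ j / qpoch q q j) * norm (f (q ^ j)) \<le> a k * (q ^ j / qpoch q q j) * K"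
      using q pos [of j] pinf f [OF q_power_in_unit]
      by (intro mult_mono mult_left_mono divide_right_mono) (auto simp: a_def)
    moreover have "norm (h k j) = a k * ((q * q ^ k) ^ j / qpoch q q j) * norm (f (q ^ j))"
      using q x pos pinf by (simp add: h_def a_def abs_mult abs_of_pos power_abs power2_eq_square mult_ac)
    ultimately show ?thesis by (simp add: b_def mult_ac)
  qed
  have a: "summable a" "\<And>k. 0 \<le> a k"
  proof -
    show "summable a"
      unfolding a_def using x by (intro summable_mult summable_geometric_over_qpoch) simp
    show "0 \<le> a k" for k
      unfolding a_def using pinf by simp
  qed
  have b: "summable b" "\<And>j. 0 \<le> b j"
  proof -
    show "summable b"
      unfolding b_def by (intro summable_mult summable_q_power_over_qpoch)
    show "0 \<le> b j" for j
      unfolding b_def using K q pos [of j] by simp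
  qed
  have "(\<Sum>k. p_inf q k x *\<^sub>R A_inf q k f) = (\<Sum>k. \<Sum>j. h k j)"
  proof (rule suminf_cong)
    fix k
    have "(\<lambda>j. h k j) sums (p_inf q k x *\<^sub>R A_inf q k f)"
      using sums_scaleR_right [OF A_inf_sums [where f = f and k = k, OF f], of "p_inf q k x"]
      by (simp add: h_def p_inf_def)
    then show "p_inf q k x *\<^sub>R A_inf q k f = (\<Sum>j. h k j)" by (rule sums_unique)
  qed
  also have "\<dots> = (\<Sum>j. \<Sum>k. h k j)"
    by (rule suminf_swap_product_bound [OF bound a b])
  also have "\<dots> = durrmeyer_series q f (of_real x)"
    unfolding durrmeyer_series_def
  proof (rule suminf_cong)
    fix j
    have xq: "\<bar>x * q ^ j\<bar> < 1"
    proof -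
      have "x * q ^ j \<le> x * 1" using x q by (intro mult_left_mono) (auto simp: power_le_one)
      then show ?thesis using x q by simp
    qed
    let ?c = "qpoch_inf x q * (qpoch_inf q q * q ^ j / qpoch q q j)"
    have "h k j = (?c * ((x * q ^ j) ^ k / (qpoch q q k)\<^sup>2)) *\<^sub>R f (q ^ j)" for k
    proof -
      have "(q ^ k) ^ j = (q ^ j) ^ k"
        by (simp add: mult.commute flip: power_mult)
      then show ?thesis unfolding h_def power_mult_distrib by (simp only:) (simp add: power2_eq_square mult_ac)
    qed
    moreover have "(\<lambda>k. (x * q ^ j) ^ k / (qpoch q q k)\<^sup>2) sums (\<Sum>k. (x * q ^ j) ^ k / (qpoch q q k)\<^sup>2)"
      using summable_geometric_over_qpoch [OF xq, of 2]
      by (intro summable_sums) (rule summable_norm_cancel)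
    ultimately have "(\<lambda>k. h k j) sums ((?c * (\<Sum>k. (x * q ^ j) ^ k / (qpoch q q k)\<^sup>2)) *\<^sub>R f (q ^ j))"
      by (simp only:) (intro sums_scaleR_left sums_mult)
    then have "(\<Sum>k. h k j) = (?c * (\<Sum>k. (x * q ^ j) ^ k / (qpoch q q k)\<^sup>2)) *\<^sub>R f (q ^ j)"
      by (rule sums_unique [symmetric])
    also have "?c * (\<Sum>k. (x * q ^ j) ^ k / (qpoch q q k)\<^sup>2)
        = qpoch_inf q q * q ^ j / qpoch q q j * qpoch x q j * qpsi q (x * q ^ j)"
      unfolding qpsi_eq [OF xq, symmetric] qpoch_inf_split [of x j] by simp
    finally show "(\<Sum>k. h k j) = durrmeyer_term q f j (of_real x)"
      using qpsi_of_real [of "x * q ^ j", where 'a = complex]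
      by (simp add: durrmeyer_term_def of_real_qpoch scaleR_conv_of_real)
  qed
  finally show ?thesis ..
qed

text \<open>Evaluating at \<open>1\<close> yields \<open>(q;q)\<^sub>\<infinity> \<psi>(1) = 1\<close>, which is what makes the value of the series at \<open>1\<close>
  equal to \<open>f 1\<close> for every \<open>f\<close>.\<close>

lemma durrmeyer_series_one: "durrmeyer_series q (\<lambda>_. 1) = (\<lambda>_. 1)"
proof (rule entire_eqI)
  show "durrmeyer_series q (\<lambda>_. 1) holomorphic_on UNIV"
    by (rule holomorphic_durrmeyer_series [of _ 1]) simp
  fix x :: real assume x: "0 \<le> x" "x < 1"
  \<comment> \<open>Euler's identity at q^(k+1).\<close>
  have A: "A_inf q k (\<lambda>_. 1) = 1" for k
  proof -
    let ?c = "qpoch_inf q q / qpoch q q k"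
    have qk: "\<bar>q * q ^ k\<bar> < 1" using q_power_Suc_less_1 [of k] q by simp
    have E: "?c * (\<Sum>j. (q * q ^ k) ^ j / qpoch q q j) = 1"
      using q_exponential_sum [OF qk] by (simp only: qpoch_inf_q_power_Suc mult.commute)
    have "(\<lambda>j. (q * q ^ k) ^ j / qpoch q q j) sums (\<Sum>j. (q * q ^ k) ^ j / qpoch q q j)"
      using summable_geometric_over_qpoch [OF qk, of 1] unfolding power_one_right
      by (intro summable_sums) (rule summable_norm_cancel)
    from sums_scaleR_left [OF sums_mult [OF this, of ?c], of "1 :: complex"]
    have "(\<lambda>j. (?c * (q * q ^ k) ^ j / qpoch q q j) *\<^sub>R (1 :: complex)) sums 1"
      by (simp only: E scaleR_one times_divide_eq_right)
    then show ?thesis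
      using A_inf_sums [of "\<lambda>_. 1" 1 k] by (intro sums_unique2 [of _ _ 1]) auto
  qed
  have "(\<lambda>k. x ^ k / qpoch q q k) sums (\<Sum>k. x ^ k / qpoch q q k)"
    using summable_geometric_over_qpoch [of x 1] x unfolding power_one_right
    by (intro summable_sums) (rule summable_norm_cancel, simp)
  from sums_scaleR_left [OF sums_mult [OF this, of "qpoch_inf x q"], of "1 :: complex"]
  have "(\<lambda>k. p_inf q k x *\<^sub>R (1 :: complex)) sums
      ((qpoch_inf x q * (\<Sum>k. x ^ k / qpoch q q k)) *\<^sub>R 1)"
    by (simp only: p_inf_def times_divide_eq_right)
  also have "qpoch_inf x q * (\<Sum>k. x ^ k / qpoch q q k) = 1"
    using q_exponential_sum [of x] x by (simp add: mult.commute)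
  finally have "(\<lambda>k. p_inf q k x *\<^sub>R (1 :: complex)) sums 1" by simp
  then show "durrmeyer_series q (\<lambda>_. 1) (of_real x) = 1"
    using x by (simp add: durrmeyer_series_of_real [of _ 1] A sums_iff)
qed simp

text \<open>For j \<ge> 1 the symbol (1;q)_j contains the factor 1 - 1, so only j = 0 survives;
  comparison with the constant function 1 determines its coefficient.\<close>

lemma durrmeyer_series_at_1: "durrmeyer_series q f 1 = f 1"
proof -
  have "durrmeyer_term q g j 1 = 0" if "j \<notin> {0}" for g j
  proof -
    have "qpoch (1 :: complex) (of_real q) j = 0"
      unfolding qpoch_def using that by (intro prod_zero) (auto intro!: bexI [of _ 0])
    then show ?thesis by (simp add: durrmeyer_term_def)
  qed
  then have eq: "durrmeyer_series q g 1 = of_real (qpoch_inf q q) * g 1 * qpsi q 1" for g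
    unfolding durrmeyer_series_def by (subst suminf_finite [of "{0}"]) (auto simp: durrmeyer_term_def)
  show ?thesis
    using eq [of f] eq [of "\<lambda>_. 1"] durrmeyer_series_one by (simp add: mult_ac fun_eq_iff)
qed

text \<open>The series proves existence and the identity theorem uniqueness, so the description by
  \<open>THE\<close> is well defined.\<close>

lemma q_durrmeyer_entire_eq:
  assumes f: "\<And>x. x \<in> {0..1} \<Longrightarrow> norm (f x) \<le> K"
  shows "q_durrmeyer_entire q f = durrmeyer_series q f"
  unfolding q_durrmeyer_entire_def
proof (rule the_equality)
  have on_unit: "durrmeyer_series q f (of_real x) = q_durrmeyer q f x" if "x \<in> {0..1}" for x
  proof (cases "x = 1")
    case True
    then show ?thesis by (simp add: q_durrmeyer_def durrmeyer_series_at_1)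
  next
    case False
    with that have "durrmeyer_series q f (of_real x) = (\<Sum>k. p_inf q k x *\<^sub>R A_inf q k f)"
      by (intro durrmeyer_series_of_real [where f = f, OF f]) auto
    with False show ?thesis by (simp add: q_durrmeyer_def)
  qed
  show "durrmeyer_series q f holomorphic_on UNIV \<and>
      (\<forall>x\<in>{0..1}. durrmeyer_series q f (of_real x) = q_durrmeyer q f x)"
    using holomorphic_durrmeyer_series [where f = f, OF f] on_unit by blast
  fix F assume F: "F holomorphic_on UNIV \<and> (\<forall>x\<in>{0..1}. F (of_real x) = q_durrmeyer q f x)"
  then show "F = durrmeyer_series q f"
    using holomorphic_durrmeyer_series [where f = f, OF f] on_unit by (intro entire_eqI) auto
qed

section \<open>The growth estimate\<close>

lemma norm_durrmeyer_series_le: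
  assumes f: "\<And>x. x \<in> {0..1} \<Longrightarrow> norm (f x) \<le> K" and "0 < r" and z: "norm z \<le> r"
  shows "norm (durrmeyer_series q f z)
    \<le> 3 * K * qpsi q 2 * qpoch_inf (- r) q / sqrt r * (\<Sum>j. sqrt q ^ j)"
proof -
  let ?C = "3 * K * qpsi q 2 * qpoch_inf (- r) q"
  have K: "0 \<le> K" using f [of 0] norm_ge_zero [of "f 0"] by (simp del: norm_ge_zero)
  have C: "0 \<le> ?C"
    using K qpsi_nonneg [of 2] qpoch_inf_ge_1 [of r] \<open>0 < r\<close> by simp
  have geo: "summable (\<lambda>j. sqrt q ^ j)" using q by (intro summable_geometric) simp
  have "norm (durrmeyer_term q f j z) \<le> ?C / sqrt r * sqrt q ^ j" for j
  proof -
    let ?s = "sqrt q ^ j" and ?t = "sqrt r"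
    have s: "q ^ j = ?s\<^sup>2" using q by (simp add: power2_eq_square flip: power_mult_distrib)
    have t: "r = ?t\<^sup>2" "0 < ?t" using \<open>0 < r\<close> by auto
    have "0 \<le> ?s" using q by simp
    \<comment> \<open>With u = \<open>?t * ?s\<close>, the square (u - 1)^2 \<ge> 0 gives 1 + u^2
      \<ge> 2u \<ge> u. Half of the decay of q^j pays for the factor 1/sqrt r, and the other half
      keeps the series geometric.\<close>
    have "0 \<le> ?t * ?s" using t \<open>0 \<le> ?s\<close> by simp
    moreover have "0 \<le> (?t * ?s - 1)\<^sup>2" by simp
    moreover have "(?t * ?s - 1)\<^sup>2 = 1 + r * q ^ j - 2 * (?t * ?s)"
      unfolding s power2_diff power_mult_distrib using t by simp
    ultimately have "?t * ?s \<le> 1 + r * q ^ j" by linarith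
    then have "?s * (?t * ?s) \<le> ?s * (1 + r * q ^ j)"
      using \<open>0 \<le> ?s\<close> by (rule mult_left_mono)
    moreover have "0 < 1 + r * q ^ j" using \<open>0 < r\<close> q by (simp add: add_pos_pos)
    ultimately have "q ^ j / (1 + r * q ^ j) \<le> ?s / ?t"
      using t(2) by (simp add: divide_le_eq pos_le_divide_eq s power2_eq_square mult_ac)
    then have "?C * (q ^ j / (1 + r * q ^ j)) \<le> ?C * (?s / ?t)"
      using C by (rule mult_left_mono)
    then show ?thesis using norm_durrmeyer_term_le [where f = f and j = j, OF f z] by simp
  qed
  then have "norm (durrmeyer_series q f z) \<le> (\<Sum>j. ?C / sqrt r * sqrt q ^ j)"
    unfolding durrmeyer_series_def by (intro norm_suminf_le summable_mult geo)
  then show ?thesis by (simp only: suminf_mult [OF geo])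
qed

end

theorem corollary2p5:
  fixes q :: real and f :: "real \<Rightarrow> complex"
  assumes "0 < q" and "q < 1" and "continuous_on {0..1} f"
  shows "(\<lambda>r. max_modulus r (q_durrmeyer_entire q f)) \<in> o[at_top](\<lambda>r. qpoch_inf (- r) q)"
proof -
  note q = assms(1,2)
  have "bounded (f ` {0..1})"
    using compact_continuous_image [OF assms(3)] by (auto intro: compact_imp_bounded)
  then obtain K where f: "\<And>x. x \<in> {0..1} \<Longrightarrow> norm (f x) \<le> K"
    unfolding bounded_iff by blast
  have entire: "q_durrmeyer_entire q f = durrmeyer_series q f"
    by (rule q_durrmeyer_entire_eq [OF q f])
  let ?M = "\<lambda>r. max_modulus r (durrmeyer_series q f)"
  define C where "C = 3 * K * qpsi q 2 * (\<Sum>j. sqrt q ^ j)"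
  have bound: "norm (?M r / qpoch_inf (- r) q) \<le> C / sqrt r" if r: "0 < r" for r
  proof -
    have G: "1 \<le> qpoch_inf (- r) q" using r by (intro qpoch_inf_ge_1 q) simp
    \<comment> \<open>Continuity makes the supremum attained, so the pointwise bound at a maximiser
      suffices.\<close>
    have "continuous_on (cball 0 r) (durrmeyer_series q f)"
      by (rule continuous_on_subset [OF holomorphic_on_imp_continuous_on
            [OF holomorphic_durrmeyer_series [where f = f, OF q f]]]) auto
    then obtain z where "z \<in> cball 0 r" "?M r = norm (durrmeyer_series q f z)"
      using max_modulus_attained [of r] r by (meson less_imp_le)
    moreover from this have "norm (durrmeyer_series q f z) \<le> C / sqrt r * qpoch_inf (- r) q"
      using norm_durrmeyer_series_le [where z = z and f = f, OF q f r] by (simp add: C_def mult_ac)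
    ultimately show ?thesis using G by (simp add: pos_divide_le_eq)
  qed
  have "((\<lambda>r. C / sqrt r) \<longlongrightarrow> 0) at_top"
    by (intro tendsto_divide_0 [OF tendsto_const] filterlim_at_top_imp_at_infinity sqrt_at_top)
  then have "((\<lambda>r. ?M r / qpoch_inf (- r) q) \<longlongrightarrow> 0) at_top"
    by (rule Lim_null_comparison [rotated]) (rule eventually_mono [OF eventually_gt_at_top [of 0] bound])
  moreover have "\<forall>\<^sub>F r in at_top. qpoch_inf (- r) q \<noteq> 0"
    using eventually_ge_at_top [of 0]
    by (rule eventually_mono) (use qpoch_inf_ge_1 [OF q] in fastforce)
  ultimately show ?thesis
    unfolding entire by (rule smalloI_tendsto)
qed

end
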